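(* Let $k \geq 2$ be an integer. Let $X_{2,k}$ be the set of $k$-element multisets with elements in $\{0,1\}$, let $T_{2,k}: X_{2,k} \to X_{2,k}$ be the map that increments each element of a multiset by $1$ modulo $2$, and for $1 \leq i \leq k$ let $g_i: X_{2,k} \to \mathbb{C}$ send a multiset to its $i$th smallest element (counted with multiplicity). Let $V$ be the complex linear span of the functions $g_i \circ T_{2,k}^j$ ($1 \leq i \leq k$, $j \in \{0,1\}$), and let $U_{2,k}: V \to V$ be the linear operator $f \mapsto f \circ T_{2,k}$. Then the multiplicities of the eigenvalues $1$ and $-1$ of $U_{2,k}$ are $\lceil (k+1)/2 \rceil$ and $\lfloor (k+1)/2 \rfloor$ respectively.
   Context: A $k$-element multiset $x$ is written as a weakly increasing sequence $x_1 \leq x_2 \leq \cdots \leq x_k$, and $g_i(x) = x_i$. Here $T_{2,k}$ exchanges $0$'s and $1$'s (followed by re-sorting). Since $U_{2,k}^2 = I$, the operator $U_{2,k}$ is diagonalizable, and the multiplicity of an eigenvalue $\zeta$ is the dimension over $\mathbb{C}$ of the eigenspace $\{f \in V : U_{2,k} f = \zeta f\}$. *)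

theory Defs
  imports Complex_Main "HOL-Library.Multiset" "HOL-Library.Function_Algebras"
begin

definition X_set :: "nat \<Rightarrow> nat \<Rightarrow> nat multiset set" where
  "X_set n k = {x. size x = k \<and> set_mset x \<subseteq> {..<n}}"

definition T_map :: "nat \<Rightarrow> nat multiset \<Rightarrow> nat multiset" where
  "T_map n x = image_mset (\<lambda>a. (a + 1) mod n) x"

text \<open>Complex functions on a set \<open>A\<close> are represented by total functions that vanish outside
  \<open>A\<close>. Restriction is needed after each composition, because \<open>T_map n\<close> sends some multisets
  outside \<open>X_set n k\<close> into \<open>X_set n k\<close>.\<close>

definition fun_on :: "'a set \<Rightarrow> ('a \<Rightarrow> complex) \<Rightarrow> 'a \<Rightarrow> complex" where
  "fun_on A f = (\<lambda>x. if x \<in> A then f x else 0)"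

text \<open>The index \<open>i\<close> is 1-based.\<close>

definition g_fun :: "nat \<Rightarrow> nat \<Rightarrow> nat \<Rightarrow> nat multiset \<Rightarrow> complex" where
  "g_fun n k i = fun_on (X_set n k) (\<lambda>x. of_nat (sorted_list_of_multiset x ! (i - 1)))"

definition cscale :: "complex \<Rightarrow> ('a \<Rightarrow> complex) \<Rightarrow> 'a \<Rightarrow> complex" where
  "cscale c f = (\<lambda>x. c * f x)"

global_interpretation cfun: vector_space "cscale :: complex \<Rightarrow> ('a \<Rightarrow> complex) \<Rightarrow> 'a \<Rightarrow> complex"
  by unfold_locales (auto simp: cscale_def algebra_simps)

definition V_space :: "nat \<Rightarrow> nat \<Rightarrow> (nat multiset \<Rightarrow> complex) set" where
  "V_space n k =
    cfun.span {fun_on (X_set n k) (g_fun n k i \<circ> (T_map n ^^ j)) | i j. i \<in> {1..k} \<and> j < n}"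

definition U_op :: "nat \<Rightarrow> nat \<Rightarrow> (nat multiset \<Rightarrow> complex) \<Rightarrow> nat multiset \<Rightarrow> complex" where
  "U_op n k f = fun_on (X_set n k) (f \<circ> T_map n)"

definition eigenspace :: "nat \<Rightarrow> nat \<Rightarrow> complex \<Rightarrow> (nat multiset \<Rightarrow> complex) set" where
  "eigenspace n k \<zeta> = {f \<in> V_space n k. U_op n k f = cscale \<zeta> f}"

definition eig_mult :: "nat \<Rightarrow> nat \<Rightarrow> complex \<Rightarrow> nat" where
  "eig_mult n k \<zeta> = cfun.dim (eigenspace n k \<zeta>)"

text \<open>\<open>U_op n k\<close> is a well-defined linear operator on \<open>V_space n k\<close>.\<close>

lemma T_in_X: "n > 0 \<Longrightarrow> x \<in> X_set n k \<Longrightarrow> T_map n x \<in> X_set n k"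
  by (auto simp: X_set_def T_map_def)

lemma T_funpow: "x \<in> X_set n k \<Longrightarrow> (T_map n ^^ j) x = image_mset (\<lambda>a. (a + j) mod n) x"
proof (induction j)
  case 0
  have "image_mset (\<lambda>a. (a + 0) mod n) x = image_mset id x"
    using 0 by (intro image_mset_cong) (auto simp: X_set_def)
  then show ?case by simp
next
  case (Suc j)
  then show ?case by (simp add: T_map_def multiset.map_comp o_def mod_Suc_eq)
qed

lemma T_funpow_n: "x \<in> X_set n k \<Longrightarrow> (T_map n ^^ n) x = x"
  using T_funpow[of x n k n] T_funpow[of x n k 0] by simp

lemma U_linear:
  "U_op n k (f + h) = U_op n k f + U_op n k h"
  "U_op n k (cscale c f) = cscale c (U_op n k f)"
  "U_op n k 0 = 0"
  by (auto simp: U_op_def fun_on_def cscale_def fun_eq_iff)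

lemma U_in_V:
  assumes "n > 0" "f \<in> V_space n k"
  shows "U_op n k f \<in> V_space n k"
  using assms(2) unfolding V_space_def
proof (induction rule: cfun.span_induct_alt)
  case base
  show ?case unfolding U_linear by (rule cfun.span_zero)
next
  case (step c h f)
  then obtain i j where h: "h = fun_on (X_set n k) (g_fun n k i \<circ> (T_map n ^^ j))" "i \<in> {1..k}" "j < n"
    by blast
  have Uh: "U_op n k h = fun_on (X_set n k) (g_fun n k i \<circ> (T_map n ^^ Suc j))"
    using T_in_X[OF assms(1)]
    by (auto simp: h(1) U_op_def fun_on_def fun_eq_iff funpow_swap1)
  have "\<exists>j' < n. U_op n k h = fun_on (X_set n k) (g_fun n k i \<circ> (T_map n ^^ j'))"
  proof (cases "Suc j = n")
    case True
    then have "U_op n k h = fun_on (X_set n k) (g_fun n k i \<circ> (T_map n ^^ 0))"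
      unfolding Uh by (auto simp: fun_on_def fun_eq_iff T_funpow_n simp del: funpow.simps)
    then show ?thesis using assms(1) by blast
  next
    case False
    then show ?thesis using Uh h(3) by (metis Suc_lessI)
  qed
  then have "U_op n k h \<in> {fun_on (X_set n k) (g_fun n k i \<circ> (T_map n ^^ j)) | i j. i \<in> {1..k} \<and> j < n}"
    using h(2) by blast
  then show ?case
    using step(2) unfolding U_linear by (blast intro: cfun.span_add cfun.span_scale cfun.span_base)
qed

end

theory Submission
  imports Defs
begin

text \<open>A multiset in \<open>X_set 2 k\<close> is determined by its number \<open>m\<close> of ones, and \<open>T_map 2\<close> acts as
  \<open>m \<mapsto> k - m\<close>. Since \<open>g\<^sub>i\<close> is the indicator of \<open>m > k - i\<close>, differences of consecutive \<open>g\<^sub>i\<close> give the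
  point masses at \<open>m \<ge> 1\<close>, and \<open>g\<^sub>1 \<circ> T\<close> is the point mass at \<open>m = 0\<close>; so \<open>V\<close> contains all functions on
  the \<open>k + 1\<close> points. The eigenspaces for \<open>1\<close> and \<open>-1\<close> are therefore the functions that are
  symmetric and antisymmetric under \<open>m \<mapsto> k - m\<close>, which are determined freely by their values at
  \<open>2 * m \<le> k\<close> and \<open>2 * m < k\<close>.\<close>

section \<open>Dimension from dual points\<close>

lemma sum_fun_apply: "(\<Sum>i\<in>I. F i) x = (\<Sum>i\<in>I. F i x)"
  for F :: "'i \<Rightarrow> 'a \<Rightarrow> 'b::comm_monoid_add"
  by (induction I rule: infinite_finite_induct) auto

text \<open>Evaluating at \<open>p j\<close> isolates the coefficient of \<open>b j\<close>, which
  gives independence; \<open>expand\<close> gives spanning. The values at the points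
  \<open>p\<close> thus serve as coordinates on \<open>W\<close>.\<close>

lemma dim_eq_card_dual_points:
  fixes W :: "('a \<Rightarrow> complex) set" and b :: "'i \<Rightarrow> 'a \<Rightarrow> complex"
  assumes "finite I"
    and mem: "\<And>i. i \<in> I \<Longrightarrow> b i \<in> W"
    and dual: "\<And>i j. i \<in> I \<Longrightarrow> j \<in> I \<Longrightarrow> b i (p j) = (if i = j then 1 else 0)"
    and expand: "\<And>f. f \<in> W \<Longrightarrow> f = (\<Sum>i\<in>I. cscale (f (p i)) (b i))"
  shows "cfun.dim W = card I"
proof -
  have inj: "inj_on b I"
    by (rule inj_onI) (metis dual one_neq_zero)
  have indep: "cfun.independent (b ` I)"
  proof (rule cfun.independent_if_scalars_zero)
    show "finite (b ` I)"
      using \<open>finite I\<close> by simp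
    fix u h
    assume 0: "(\<Sum>v\<in>b ` I. cscale (u v) v) = 0" and "h \<in> b ` I"
    then obtain j where j: "j \<in> I" "h = b j"
      by blast
    have "0 = (\<Sum>i\<in>I. cscale (u (b i)) (b i)) (p j)"
      using 0 by (simp add: sum.reindex[OF inj])
    also have "\<dots> = (\<Sum>i\<in>I. if i = j then u (b i) else 0)"
      unfolding sum_fun_apply by (rule sum.cong) (auto simp: cscale_def dual j)
    also have "\<dots> = u h"
      using \<open>finite I\<close> j by simp
    finally show "u h = 0"
      by simp
  qed
  have "W \<subseteq> cfun.span (b ` I)"
  proof
    fix f
    assume "f \<in> W"
    have "(\<Sum>i\<in>I. cscale (f (p i)) (b i)) \<in> cfun.span (b ` I)"
      by (intro cfun.span_sum cfun.span_scale cfun.span_base) simp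
    then show "f \<in> cfun.span (b ` I)"
      using expand[OF \<open>f \<in> W\<close>] by simp
  qed
  moreover have "b ` I \<subseteq> W"
    using mem by blast
  ultimately have "cfun.dim W = card (b ` I)"
    using indep by (metis cfun.dim_unique)
  then show ?thesis
    by (simp add: card_image[OF inj])
qed

section \<open>Multisets of zeros and ones\<close>

definition binary_mset :: "nat \<Rightarrow> nat \<Rightarrow> nat multiset" where
  "binary_mset k m = replicate_mset (k - m) 0 + replicate_mset m 1"

text \<open>Counting ones recovers \<open>m\<close> even for \<open>m > k\<close>, where the
  truncated \<open>k - m\<close> is 0.\<close>

lemma binary_mset_eq_iff [simp]: "binary_mset k m = binary_mset k m' \<longleftrightarrow> m = m'"
proof
  assume "binary_mset k m = binary_mset k m'"
  then have "count (binary_mset k m) 1 = count (binary_mset k m') 1"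
    by simp
  then show "m = m'"
    by (simp add: binary_mset_def)
qed simp

lemma X_set_2: "X_set 2 k = binary_mset k ` {..k}"
proof (intro equalityI subsetI)
  fix x
  assume x: "x \<in> X_set 2 k"
  have eq: "x = replicate_mset (count x 0) 0 + replicate_mset (count x 1) 1"
  proof (rule multiset_eqI)
    fix a
    have "a = 0 \<or> a = 1 \<or> a \<notin># x"
      using x by (auto simp: X_set_def)
    then show "count x a = count (replicate_mset (count x 0) 0 + replicate_mset (count x 1) 1) a"
      by (auto simp: not_in_iff)
  qed
  from arg_cong[OF eq, of size] have "size x = count x 0 + count x 1"
    by (simp only: size_union size_replicate_mset)
  then have c: "count x 0 = k - count x 1" "count x 1 \<le> k"
    using x by (auto simp: X_set_def)
  have "x = binary_mset k (count x 1)"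
    using eq unfolding binary_mset_def c(1) .
  then show "x \<in> binary_mset k ` {..k}"
    using c(2) by (rule image_eqI[OF _ atMost_iff[THEN iffD2]])
qed (auto simp: X_set_def binary_mset_def split: if_splits)

lemma binary_mset_in_X_set [simp]: "m \<le> k \<Longrightarrow> binary_mset k m \<in> X_set 2 k"
  by (simp add: X_set_2)

lemma T_map_binary_mset [simp]: "m \<le> k \<Longrightarrow> T_map 2 (binary_mset k m) = binary_mset k (k - m)"
  by (simp add: T_map_def binary_mset_def add.commute)

lemma sorted_list_of_binary_mset:
  "sorted_list_of_multiset (binary_mset k m) = replicate (k - m) 0 @ replicate m 1"
proof -
  have "binary_mset k m = mset (replicate (k - m) 0 @ replicate m 1)"
    by (simp add: binary_mset_def)
  moreover have "sorted (replicate (k - m) (0::nat) @ replicate m 1)"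
    by (auto simp: sorted_append)
  ultimately show ?thesis
    by (metis sorted_list_of_multiset_mset sorted_sort_id)
qed

text \<open>The zeros fill the first \<open>k - m\<close> places, so the 1-based place
  \<open>i\<close> holds a one exactly if \<open>i > k - m\<close>.\<close>

lemma g_fun_binary_mset:
  assumes "m \<le> k" "i \<in> {1..k}"
  shows "g_fun 2 k i (binary_mset k m) = (if k < i + m then 1 else 0)"
  using assms by (auto simp: g_fun_def fun_on_def sorted_list_of_binary_mset nth_append)

section \<open>\<open>V_space 2 k\<close> as a full function space\<close>

definition point_mass :: "'a \<Rightarrow> 'a \<Rightarrow> complex" where
  "point_mass p = (\<lambda>x. if x = p then 1 else 0)"

lemma point_mass_in_V_space:
  assumes "k \<ge> 1" "m \<le> k"
  shows "point_mass (binary_mset k m) \<in> V_space 2 k"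
proof -
  let ?G = "\<lambda>i j. fun_on (X_set 2 k) (g_fun 2 k i \<circ> (T_map 2 ^^ j))"
  have G: "?G i j \<in> V_space 2 k" if "i \<in> {1..k}" "j < 2" for i j
    unfolding V_space_def using that by (intro cfun.span_base) blast
  \<comment> \<open>The difference of consecutive \<open>g_fun\<close> uses the indices
    \<open>Suc k - m\<close> and \<open>k - m\<close>, which both lie in \<open>{1..k}\<close> only
    for \<open>0 < m < k\<close>.\<close>
  consider "m = 0" | "m = k" | "0 < m" "m < k"
    using assms by linarith
  then show ?thesis
  proof cases
    case 1
    \<comment> \<open>Index 1 picks the minimum, which is 1 only on the all-ones multiset;
      \<open>T_map 2\<close> moves this point to the all-zeros one.\<close>
    have "point_mass (binary_mset k m) = ?G 1 1"
      using assms 1 by (auto simp: fun_eq_iff point_mass_def fun_on_def X_set_2 g_fun_binary_mset)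
    then show ?thesis
      using G[of 1 1] assms by simp
  next
    case 2
    have "point_mass (binary_mset k m) = ?G 1 0"
      using assms 2 by (auto simp: fun_eq_iff point_mass_def fun_on_def X_set_2 g_fun_binary_mset)
    then show ?thesis
      using G[of 1 0] assms by simp
  next
    case 3
    have "g_fun 2 k (Suc k - m) (binary_mset k m') = (if m \<le> m' then 1 else 0)"
      "g_fun 2 k (k - m) (binary_mset k m') = (if m < m' then 1 else 0)" if "m' \<le> k" for m'
      using 3 that by (subst g_fun_binary_mset; auto)+
    then have "point_mass (binary_mset k m) = ?G (Suc k - m) 0 - ?G (k - m) 0"
      using 3 by (auto simp: fun_eq_iff point_mass_def fun_on_def X_set_2)
    moreover have "?G (Suc k - m) 0 - ?G (k - m) 0 \<in> V_space 2 k"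
      unfolding V_space_def
      by (intro cfun.span_diff G[unfolded V_space_def]) (use 3 in auto)
    ultimately show ?thesis
      by simp
  qed
qed

text \<open>Turns membership in the span into a support condition: the generators vanish off
  \<open>X_set 2 k\<close>, and a function supported there is a combination of point masses.\<close>

lemma V_space_2:
  assumes "k \<ge> 1"
  shows "V_space 2 k = {f. \<forall>x. x \<notin> X_set 2 k \<longrightarrow> f x = 0}"
proof (intro equalityI subsetI)
  fix f
  assume "f \<in> V_space 2 k"
  then show "f \<in> {f. \<forall>x. x \<notin> X_set 2 k \<longrightarrow> f x = 0}"
    unfolding V_space_def
    by (induction rule: cfun.span_induct_alt) (auto simp: fun_on_def cscale_def)
next
  fix f :: "nat multiset \<Rightarrow> complex"
  assume f: "f \<in> {f. \<forall>x. x \<notin> X_set 2 k \<longrightarrow> f x = 0}"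
  have "f = (\<Sum>m\<le>k. cscale (f (binary_mset k m)) (point_mass (binary_mset k m)))"
    (is "f = ?S")
  proof
    fix x
    show "f x = ?S x"
    proof (cases "x \<in> X_set 2 k")
      case True
      then show ?thesis
        by (auto simp: X_set_2 sum_fun_apply cscale_def point_mass_def if_distrib cong: if_cong)
    next
      case False
      then show ?thesis
        using f by (auto simp: sum_fun_apply cscale_def point_mass_def intro!: sum.neutral)
    qed
  qed
  also have "?S \<in> V_space 2 k"
    using point_mass_in_V_space[OF assms] unfolding V_space_def
    by (intro cfun.span_sum cfun.span_scale) simp
  finally show "f \<in> V_space 2 k" .
qed

section \<open>Eigenspaces and their dimensions\<close>

lemma eigenspace_2_iff:
  assumes "k \<ge> 1"
  shows "f \<in> eigenspace 2 k s \<longleftrightarrow>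
    (\<forall>x. x \<notin> X_set 2 k \<longrightarrow> f x = 0) \<and>
    (\<forall>m\<le>k. f (binary_mset k (k - m)) = s * f (binary_mset k m))"
proof -
  have "U_op 2 k f = cscale s f \<longleftrightarrow>
      (\<forall>m\<le>k. f (binary_mset k (k - m)) = s * f (binary_mset k m))"
    if f: "\<forall>x. x \<notin> X_set 2 k \<longrightarrow> f x = 0"
  proof -
    \<comment> \<open>Off \<open>X_set 2 k\<close> both sides vanish.\<close>
    have "U_op 2 k f = cscale s f \<longleftrightarrow> (\<forall>x\<in>X_set 2 k. f (T_map 2 x) = s * f x)"
      using f by (auto simp: U_op_def fun_on_def cscale_def fun_eq_iff)
    then show ?thesis
      by (auto simp: X_set_2)
  qed
  then show ?thesis
    by (auto simp: eigenspace_def V_space_2[OF assms])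
qed

text \<open>The set \<open>I\<close> selects one point from each orbit of \<open>m \<mapsto> k - m\<close>, except that the fixed point has
  to be omitted when \<open>s = -1\<close>, because eigenfunctions vanish there.\<close>

lemma eig_mult_2:
  assumes "k \<ge> 1" and s: "s * s = 1"
    and I: "I \<subseteq> {m. 2 * m \<le> k}" "\<And>m. 2 * m < k \<Longrightarrow> m \<in> I"
    and fixed: "\<And>m. 2 * m = k \<Longrightarrow> m \<in> I \<longleftrightarrow> s = 1"
  shows "eig_mult 2 k s = card I"
proof -
  \<comment> \<open>The point mass at \<open>m\<close>, extended to the mirror point
    \<open>k - m\<close> by the eigenvalue equation; if the two points coincide, the first branch
    gives 1.\<close>
  define b where "b m = (\<lambda>x. if x = binary_mset k m then 1
      else if x = binary_mset k (k - m) then s else 0)" for m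
  have le: "2 * m \<le> k" if "m \<in> I" for m
    using that I by blast
  have "I \<subseteq> {..k}"
    using le by fastforce
  then have fin: "finite I"
    by (rule finite_subset) simp
  have b_dual: "b i (binary_mset k j) = (if i = j then 1 else 0)" if "i \<in> I" "j \<in> I" for i j
    using le[OF that(1)] le[OF that(2)] by (auto simp: b_def)
  have b_dual': "b i (binary_mset k (k - j)) = (if i = j then s else 0)"
    if "i \<in> I" "j \<in> I" "2 * j \<noteq> k" for i j
    using le[OF that(1)] le[OF that(2)] that(3) by (auto simp: b_def)
  show ?thesis
    unfolding eig_mult_def
  proof (rule dim_eq_card_dual_points[OF fin, where b = b and p = "binary_mset k"])
    fix i
    assume i: "i \<in> I"
    have "b i (binary_mset k (k - m)) = s * b i (binary_mset k m)" if "m \<le> k" for m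
    proof (cases "2 * i = k")
      case True
      then show ?thesis
        using i fixed[of i] that by (auto simp: b_def)
    next
      case False
      \<comment> \<open>At \<open>m = k - i\<close> the equation reads
        \<open>1 = s * s\<close>.\<close>
      then show ?thesis
        using le[OF i] that s by (auto simp: b_def)
    qed
    moreover have "b i x = 0" if "x \<notin> X_set 2 k" for x
      using that le[OF i] by (auto simp: b_def)
    ultimately show "b i \<in> eigenspace 2 k s"
      by (simp add: eigenspace_2_iff[OF \<open>k \<ge> 1\<close>])
  next
    fix i j
    assume "i \<in> I" "j \<in> I"
    then show "b i (binary_mset k j) = (if i = j then 1 else 0)"
      by (rule b_dual)
  next
    fix f
    assume "f \<in> eigenspace 2 k s"
    then have f0: "\<And>x. x \<notin> X_set 2 k \<Longrightarrow> f x = 0"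
      and fs: "\<And>m. m \<le> k \<Longrightarrow> f (binary_mset k (k - m)) = s * f (binary_mset k m)"
      by (auto simp: eigenspace_2_iff[OF \<open>k \<ge> 1\<close>])
    show "f = (\<Sum>i\<in>I. cscale (f (binary_mset k i)) (b i))" (is "f = ?S")
    proof
      fix x
      show "f x = ?S x"
      proof (cases "x \<in> X_set 2 k")
        case False
        then have "b i x = 0" if "i \<in> I" for i
          using le[OF that] by (auto simp: b_def)
        then show ?thesis
          using False by (simp add: f0 sum_fun_apply cscale_def)
      next
        case True
        then obtain m where m: "m \<le> k" "x = binary_mset k m"
          by (auto simp: X_set_2)
        \<comment> \<open>Either \<open>m\<close> or its mirror point is selected, unless
          \<open>m\<close> is an omitted fixed point.\<close>
        have "m \<in> I \<or> k - m \<in> I \<and> 2 * m > k \<or> 2 * m = k \<and> m \<notin> I"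
          using I(2)[of m] I(2)[of "k - m"] m(1) by linarith
        then consider "m \<in> I" | "k - m \<in> I" "2 * m > k" | "m \<notin> I" "2 * m = k"
          by blast
        then show ?thesis
        proof cases
          case 1
          have "?S x = (\<Sum>i\<in>I. if i = m then f x else 0)"
            unfolding sum_fun_apply by (rule sum.cong) (auto simp: cscale_def m b_dual 1)
          then show ?thesis
            using 1 fin by simp
        next
          case 2
          define j where "j = k - m"
          have j: "j \<in> I" "2 * j \<noteq> k" "j \<le> k" "x = binary_mset k (k - j)"
            using 2 m by (auto simp: j_def)
          have "?S x = (\<Sum>i\<in>I. if i = j then s * f (binary_mset k j) else 0)"
            unfolding sum_fun_apply by (rule sum.cong) (auto simp: cscale_def j b_dual')
          then show ?thesis
            using fin j fs[of j] by simp
        next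
          case 3
          then have "s \<noteq> 1"
            using fixed by blast
          moreover have "k - m = m"
            using 3 by simp
          ultimately have "f x = 0"
            using fs[of m] m by auto
          moreover have "b i x = 0" if "i \<in> I" for i
            using 3 m le[OF that] that by (auto simp: b_def)
          ultimately show ?thesis
            by (simp add: sum_fun_apply cscale_def)
        qed
      qed
    qed
  qed
qed

theorem proposition4p1:
  fixes k :: nat
  assumes "k \<ge> 2"
  shows "int (eig_mult 2 k 1) = \<lceil>(real k + 1) / 2\<rceil>
       \<and> int (eig_mult 2 k (-1)) = \<lfloor>(real k + 1) / 2\<rfloor>"
proof
  \<comment> \<open>For even \<open>k\<close> this range includes the fixed point
    \<open>k div 2\<close>.\<close>
  have "eig_mult 2 k 1 = card {..k div 2}"
    using assms by (intro eig_mult_2) auto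
  then show "int (eig_mult 2 k 1) = \<lceil>(real k + 1) / 2\<rceil>"
    by (cases "even k") (auto elim!: evenE oddE intro!: ceiling_unique[symmetric])
  \<comment> \<open>For even \<open>k\<close> this range stops just before the fixed point.\<close>
  have "eig_mult 2 k (-1) = card {..<(k + 1) div 2}"
    using assms by (intro eig_mult_2) auto
  then show "int (eig_mult 2 k (-1)) = \<lfloor>(real k + 1) / 2\<rfloor>"
    by (cases "even k") (auto elim!: evenE oddE intro!: floor_unique[symmetric])
qed

end
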